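(* Let $n\ge2$ and let $A:M_n(\mathbb R)\to M_n(\mathbb R)$ be a $*$-linear map. The following are equivalent: (i) $A$ is cross-positive; (ii) $p_A\ge0$ on $V(I)=\{(x,y)\in\mathbb R^n\times\mathbb R^n: y^Tx=0\}$; (iii) $q_A\ge0$ on $\mathbb R^{2n-1}$.
   Context: A linear map $A:M_n(\mathbb R)\to M_n(\mathbb R)$ is $*$-linear if $A(U^T)=A(U)^T$ for all $U$. It is cross-positive if for all positive semidefinite (symmetric) $U,V\in M_n(\mathbb R)$ with $\langle U,V\rangle=0$ one has $\langle A(U),V\rangle\ge0$, where $\langle B,C\rangle=\operatorname{tr}(C^TB)$. With $x=(x_1,\dots,x_n)$, $y=(y_1,\dots,y_n)$ (column) tuples of commuting variables, $p_A(x,y)=y^TA(xx^T)y\in\mathbb R[x,y]$. With $\alpha=(\alpha_1,\dots,\alpha_{n-1})$ further variables, let $\Psi(x,\alpha)=(x,y)$, where $y_1=\alpha_1x_2$, $y_i=\alpha_ix_{i+1}-\alpha_{i-1}x_{i-1}$ for $i=2,\dots,n-1$, and $y_n=-\alpha_{n-1}x_{n-1}$. Then $q_A(x,\alpha)=p_A(\Psi(x,\alpha))\in\mathbb R[x,\alpha]$. *)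

theory Defs
  imports Complex_Main "Jordan_Normal_Form.VS_Connect"
begin

text \<open>
  Elements of \<open>M\<^sub>n(\<real>)\<close> are the matrices in \<open>carrier_mat n n\<close> and elements of \<open>\<real>\<^sup>n\<close> the vectors
  in \<open>carrier_vec n\<close>. Indices start at 0, so the coordinate written \<open>x\<^sub>i\<close> on paper is \<open>x $ (i - 1)\<close>.
\<close>

definition star_linear :: "nat \<Rightarrow> (real mat \<Rightarrow> real mat) \<Rightarrow> bool" where
  "star_linear n A \<longleftrightarrow>
     linear_map class_ring (module_mat TYPE(real) n n) (module_mat TYPE(real) n n) A \<and>
     (\<forall>U \<in> carrier_mat n n. A (transpose_mat U) = transpose_mat (A U))"

lemma linear_map_mat_iff:
  "linear_map class_ring (module_mat TYPE(real) n n) (module_mat TYPE(real) n n) A \<longleftrightarrow>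
     (\<forall>U \<in> carrier_mat n n. A U \<in> carrier_mat n n) \<and>
     (\<forall>U \<in> carrier_mat n n. \<forall>V \<in> carrier_mat n n. A (U + V) = A U + A V) \<and>
     (\<forall>r. \<forall>U \<in> carrier_mat n n. A (r \<cdot>\<^sub>m U) = r \<cdot>\<^sub>m A U)"
proof -
  have vs: "vectorspace class_ring (module_mat TYPE(real) n n)"
    using matrix_vs unfolding class_field_def .
  then show ?thesis
    unfolding linear_map_def mod_hom_def mod_hom_axioms_def vectorspace_def
      LinearCombinations.module_hom_def
    by (auto simp: module_mat_def class_ring_simps)
qed

definition trace_mat :: "real mat \<Rightarrow> real" where
  "trace_mat M = (\<Sum>i<dim_row M. M $$ (i, i))"

definition inner_mat :: "real mat \<Rightarrow> real mat \<Rightarrow> real" where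
  "inner_mat B C = trace_mat (transpose_mat C * B)"

definition pos_semidef :: "nat \<Rightarrow> real mat \<Rightarrow> bool" where
  "pos_semidef n U \<longleftrightarrow> U \<in> carrier_mat n n \<and> transpose_mat U = U \<and>
     (\<forall>v \<in> carrier_vec n. v \<bullet> (U *\<^sub>v v) \<ge> 0)"

definition cross_positive :: "nat \<Rightarrow> (real mat \<Rightarrow> real mat) \<Rightarrow> bool" where
  "cross_positive n A \<longleftrightarrow>
     (\<forall>U V. pos_semidef n U \<longrightarrow> pos_semidef n V \<longrightarrow> inner_mat U V = 0 \<longrightarrow> inner_mat (A U) V \<ge> 0)"

definition outer_square :: "real vec \<Rightarrow> real mat" where
  "outer_square x = mat (dim_vec x) (dim_vec x) (\<lambda>(i, j). x $ i * x $ j)"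

text \<open>
  The real polynomials \<open>p\<^sub>A\<close> and \<open>q\<^sub>A\<close> are represented by the polynomial functions they induce. Since
  \<open>\<real>\<close> is infinite this loses nothing, and substituting \<open>\<Psi>\<close> becomes composition of functions.
\<close>

definition p_poly :: "(real mat \<Rightarrow> real mat) \<Rightarrow> real vec \<times> real vec \<Rightarrow> real" where
  "p_poly A = (\<lambda>(x, y). y \<bullet> (A (outer_square x) *\<^sub>v y))"

definition V_I :: "nat \<Rightarrow> (real vec \<times> real vec) set" where
  "V_I n = {(x, y). x \<in> carrier_vec n \<and> y \<in> carrier_vec n \<and> y \<bullet> x = 0}"

text \<open>
  Intended for \<open>x \<in> carrier_vec n\<close> and \<open>\<alpha> \<in> carrier_vec (n - 1)\<close> with \<open>n \<ge> 2\<close>.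
\<close>

definition Psi :: "nat \<Rightarrow> real vec \<times> real vec \<Rightarrow> real vec \<times> real vec" where
  "Psi n = (\<lambda>(x, \<alpha>). (x, vec n (\<lambda>i.
     if i = 0 then \<alpha> $ 0 * x $ 1
     else if i = n - 1 then - (\<alpha> $ (n - 2) * x $ (n - 2))
     else \<alpha> $ i * x $ (i + 1) - \<alpha> $ (i - 1) * x $ (i - 1))))"

definition q_poly :: "nat \<Rightarrow> (real mat \<Rightarrow> real mat) \<Rightarrow> real vec \<times> real vec \<Rightarrow> real" where
  "q_poly n A = p_poly A \<circ> Psi n"

end

theory Submission
  imports Defs
begin

text \<open>
  Everything rests on the identity \<open>p\<^sub>A(x, y) = \<langle>A(xx\<^sup>T), yy\<^sup>T\<rangle>\<close> together with
  \<open>\<langle>xx\<^sup>T, yy\<^sup>T\<rangle> = (y\<^sup>Tx)\<^sup>2\<close>, its case \<open>A = id\<close>.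

  Cross-positivity is thus equivalent to \<open>p\<^sub>A \<ge> 0\<close> on \<open>V(I)\<close> as soon as every positive semidefinite
  matrix is known to be a finite sum of matrices \<open>xx\<^sup>T\<close> (\<open>pos_semidef_sum_of_squares\<close>): if
  \<open>U = \<Sum>xx\<^sup>T\<close> and \<open>V = \<Sum>yy\<^sup>T\<close> are orthogonal, then \<open>\<Sum>(y\<^sup>Tx)\<^sup>2 = 0\<close>, so all the pairs \<open>(x, y)\<close> lie
  in \<open>V(I)\<close>, and \<open>\<langle>A(U), V\<rangle>\<close> is the sum of the values \<open>p\<^sub>A(x, y)\<close>. The decomposition needs no
  spectral theorem: Gaussian elimination on a positive diagonal entry splits off one rank-one
  summand and leaves a positive semidefinite remainder, by the Cauchy-Schwarz inequality.

  For the polynomial \<open>q\<^sub>A\<close>, the image of \<open>\<Psi>\<close> lies in \<open>V(I)\<close> because \<open>y\<^sup>Tx\<close> telescopes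
  (\<open>Psi_in_V_I\<close>). Conversely \<open>\<Psi>\<close> reaches every point of \<open>V(I)\<close> for which no coordinate of \<open>x\<close>
  vanishes (\<open>Psi_surj_nonvanishing\<close>). Every other point with \<open>x \<noteq> 0\<close> is, up to a positive scaling of
  \<open>y\<close>, the value at \<open>0\<close> of a polynomial curve in \<open>V(I)\<close> that consists of such points away from \<open>0\<close>,
  and continuity of \<open>p\<^sub>A\<close> along that curve transports nonnegativity. If \<open>x = 0\<close>, then
  \<open>p\<^sub>A(x, y) = 0\<close>.
\<close>

section \<open>Rank-one matrices and the trace inner product\<close>

lemma outer_square_carrier [simp]:
  "x \<in> carrier_vec n \<Longrightarrow> outer_square x \<in> carrier_mat n n"
  by (auto simp: outer_square_def)

lemma outer_square_mult_vec:
  assumes "x \<in> carrier_vec n" "v \<in> carrier_vec n"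
  shows "outer_square x *\<^sub>v v = (x \<bullet> v) \<cdot>\<^sub>v x"
  using assms
  by (intro eq_vecI) (auto simp: outer_square_def scalar_prod_def sum_distrib_left ac_simps)

lemma quadratic_form_outer_square:
  assumes "x \<in> carrier_vec n" "v \<in> carrier_vec n"
  shows "v \<bullet> (outer_square x *\<^sub>v v) = (v \<bullet> x)\<^sup>2"
  using assms comm_scalar_prod[OF assms]
  by (simp add: outer_square_mult_vec power2_eq_square)

lemma pos_semidef_outer_square:
  assumes "x \<in> carrier_vec n"
  shows "pos_semidef n (outer_square x)"
  using assms unfolding pos_semidef_def
  by (auto simp: quadratic_form_outer_square) (auto simp: outer_square_def)

lemma inner_mat_eq_sum:
  assumes "B \<in> carrier_mat n n" "C \<in> carrier_mat n n"
  shows "inner_mat B C = (\<Sum>i<n. \<Sum>j<n. B $$ (j, i) * C $$ (j, i))"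
  using assms
  by (auto simp: inner_mat_def trace_mat_def scalar_prod_def atLeast0LessThan ac_simps
      intro!: sum.cong)

lemma inner_mat_add_left:
  assumes "B \<in> carrier_mat n n" "B' \<in> carrier_mat n n" "C \<in> carrier_mat n n"
  shows "inner_mat (B + B') C = inner_mat B C + inner_mat B' C"
  using assms by (simp add: inner_mat_eq_sum[of _ n] sum.distrib ring_distribs)

lemma inner_mat_add_right:
  assumes "B \<in> carrier_mat n n" "C \<in> carrier_mat n n" "C' \<in> carrier_mat n n"
  shows "inner_mat B (C + C') = inner_mat B C + inner_mat B C'"
  using assms by (simp add: inner_mat_eq_sum[of _ n] sum.distrib ring_distribs)

lemma inner_mat_zero_left:
  "C \<in> carrier_mat n n \<Longrightarrow> inner_mat (0\<^sub>m n n) C = 0"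
  by (simp add: inner_mat_eq_sum[of _ n])

lemma inner_mat_zero_right:
  "C \<in> carrier_mat n n \<Longrightarrow> inner_mat C (0\<^sub>m n n) = 0"
  by (simp add: inner_mat_eq_sum[of _ n])

lemma quadratic_form_eq_sum:
  fixes M :: "real mat"
  assumes "M \<in> carrier_mat n n" "y \<in> carrier_vec n"
  shows "y \<bullet> (M *\<^sub>v y) = (\<Sum>i<n. \<Sum>j<n. M $$ (i, j) * (y $ i * y $ j))"
  using assms
  by (auto simp: scalar_prod_def sum_distrib_left ac_simps atLeast0LessThan intro!: sum.cong)

lemma inner_mat_outer_square:
  assumes "M \<in> carrier_mat n n" "y \<in> carrier_vec n"
  shows "inner_mat M (outer_square y) = y \<bullet> (M *\<^sub>v y)"
proof -
  have "inner_mat M (outer_square y) = (\<Sum>i<n. \<Sum>j<n. M $$ (j, i) * (y $ j * y $ i))"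
    using assms by (simp add: inner_mat_eq_sum[of _ n]) (simp add: outer_square_def)
  also have "\<dots> = (\<Sum>j<n. \<Sum>i<n. M $$ (j, i) * (y $ j * y $ i))"
    by (rule sum.swap)
  finally show ?thesis
    using assms by (simp add: quadratic_form_eq_sum)
qed

section \<open>Positive semidefinite matrices are sums of rank-one squares\<close>

text \<open>
  The Cauchy-Schwarz inequality for the possibly degenerate form \<open>u\<^sup>TUv\<close>: the quadratic polynomial
  \<open>t \<mapsto> (u + tv)\<^sup>TU(u + tv)\<close> is nonnegative, hence has nonpositive discriminant.
\<close>

lemma pos_semidef_Cauchy_Schwarz:
  assumes U: "pos_semidef n U" and u: "u \<in> carrier_vec n" and v: "v \<in> carrier_vec n"
  shows "(u \<bullet> (U *\<^sub>v v))\<^sup>2 \<le> (u \<bullet> (U *\<^sub>v u)) * (v \<bullet> (U *\<^sub>v v))"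
proof -
  define a b c where "a = u \<bullet> (U *\<^sub>v u)" and "b = u \<bullet> (U *\<^sub>v v)" and "c = v \<bullet> (U *\<^sub>v v)"
  have Uc: "U \<in> carrier_mat n n" and sym: "transpose_mat U = U"
    using U by (auto simp: pos_semidef_def)
  have Uu: "U *\<^sub>v u \<in> carrier_vec n" and Uv: "U *\<^sub>v v \<in> carrier_vec n"
    using Uc u v by auto
  have b': "v \<bullet> (U *\<^sub>v u) = b"
    using transpose_vec_mult_scalar[OF Uc v u] sym comm_scalar_prod[OF u Uv]
      comm_scalar_prod[OF v Uu] by (simp add: b_def)
  have quad: "0 \<le> a + 2 * b * t + c * t\<^sup>2" for t
  proof -
    have "0 \<le> (u + t \<cdot>\<^sub>v v) \<bullet> (U *\<^sub>v (u + t \<cdot>\<^sub>v v))"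
      using U u v by (auto simp: pos_semidef_def)
    also have "U *\<^sub>v (u + t \<cdot>\<^sub>v v) = U *\<^sub>v u + t \<cdot>\<^sub>v (U *\<^sub>v v)"
      using Uc u v by (simp add: mult_add_distrib_mat_vec mult_mat_vec)
    also have "(u + t \<cdot>\<^sub>v v) \<bullet> (U *\<^sub>v u + t \<cdot>\<^sub>v (U *\<^sub>v v)) = a + 2 * b * t + c * t\<^sup>2"
      using u v Uu Uv b'
      by (simp add: add_scalar_prod_distrib[of _ n] scalar_prod_add_distrib[of _ n] a_def
          b_def[symmetric] c_def power2_eq_square algebra_simps)
    finally show ?thesis .
  qed
  have "c \<ge> 0"
    using U v by (auto simp: pos_semidef_def c_def)
  have "b\<^sup>2 \<le> a * c"
  proof (cases "c = 0")
    case True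
    \<comment> \<open>The polynomial is affine, so a nonzero slope would make it negative somewhere.\<close>
    have "b = 0"
      using quad[of "- (a + 1) / (2 * b)"] True by (cases "b = 0") auto
    with True show ?thesis by simp
  next
    case False
    with \<open>c \<ge> 0\<close> have "c > 0" by simp
    with quad[of "- b / c"] show ?thesis
      by (simp add: field_simps power2_eq_square)
  qed
  then show ?thesis by (simp add: a_def b_def c_def)
qed

lemma mat_mult_unit_vec:
  fixes U :: "real mat"
  assumes "U \<in> carrier_mat n n" "i < n"
  shows "U *\<^sub>v unit_vec n i = col U i"
  using assms by (intro eq_vecI) auto

lemma unit_vec_quadratic_form:
  fixes U :: "real mat"
  assumes "U \<in> carrier_mat n n" "i < n" "j < n"
  shows "unit_vec n i \<bullet> (U *\<^sub>v unit_vec n j) = U $$ (i, j)"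
  using assms by (simp add: mat_mult_unit_vec)

lemma pos_semidef_diag_nonneg:
  assumes "pos_semidef n U" "i < n"
  shows "U $$ (i, i) \<ge> 0"
  using assms unit_vec_quadratic_form[of U n i i] unit_vec_carrier[of n i]
  unfolding pos_semidef_def by metis

lemma pos_semidef_entry_zero:
  assumes U: "pos_semidef n U" and "i < n" "j < n" and "U $$ (i, i) = 0"
  shows "U $$ (i, j) = 0"
  using pos_semidef_Cauchy_Schwarz[OF U unit_vec_carrier[of n i] unit_vec_carrier[of n j]] assms
  by (simp add: unit_vec_quadratic_form pos_semidef_def)

definition sum_outer :: "nat \<Rightarrow> real vec list \<Rightarrow> real mat" where
  "sum_outer n xs = foldr (\<lambda>x M. outer_square x + M) xs (0\<^sub>m n n)"

lemma sum_outer_simps [simp]: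
  "sum_outer n [] = 0\<^sub>m n n"
  "sum_outer n (x # xs) = outer_square x + sum_outer n xs"
  by (simp_all add: sum_outer_def)

lemma sum_outer_carrier [simp]:
  "set xs \<subseteq> carrier_vec n \<Longrightarrow> sum_outer n xs \<in> carrier_mat n n"
  by (induction xs) auto

text \<open>
  One step of Gaussian elimination at a positive pivot: row and column \<open>m\<close> are cleared, and the
  remainder stays positive semidefinite, since its quadratic form at \<open>v\<close> is
  \<open>v\<^sup>TUv - (v\<^sup>TUe\<^sub>m)\<^sup>2 / (e\<^sub>m\<^sup>TUe\<^sub>m)\<close>.
\<close>

lemma pos_semidef_eliminate:
  assumes U: "pos_semidef n U" and m: "m < n" and pivot: "U $$ (m, m) > 0"
  defines "x \<equiv> (1 / sqrt (U $$ (m, m))) \<cdot>\<^sub>v col U m"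
  shows "pos_semidef n (U - outer_square x)"
    and "\<And>i j. i < n \<Longrightarrow> j < n \<Longrightarrow>
      (U - outer_square x) $$ (i, j) = U $$ (i, j) - U $$ (i, m) * U $$ (j, m) / U $$ (m, m)"
proof -
  let ?e = "unit_vec n m :: real vec"
  have Uc: "U \<in> carrier_mat n n" and sym: "transpose_mat U = U"
    using U by (auto simp: pos_semidef_def)
  have col: "col U m = U *\<^sub>v ?e"
    using Uc m by (simp add: mat_mult_unit_vec)
  have x: "x \<in> carrier_vec n"
    using Uc by (auto simp: x_def col_def)
  show entries: "(U - outer_square x) $$ (i, j)
      = U $$ (i, j) - U $$ (i, m) * U $$ (j, m) / U $$ (m, m)" if "i < n" "j < n" for i j
    using that Uc m pivot by (simp add: outer_square_def x_def)
  have symU: "U $$ (j, i) = U $$ (i, j)" if "i < n" "j < n" for i j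
  proof -
    have "transpose_mat U $$ (i, j) = U $$ (j, i)"
      using that Uc by simp
    then show ?thesis using sym by simp
  qed
  have "transpose_mat (U - outer_square x) = U - outer_square x"
    using Uc x symU by (intro eq_matI) (auto simp: outer_square_def)
  moreover have "v \<bullet> ((U - outer_square x) *\<^sub>v v) \<ge> 0" if v: "v \<in> carrier_vec n" for v
  proof -
    have "(v \<bullet> x)\<^sup>2 = (v \<bullet> (U *\<^sub>v ?e))\<^sup>2 / U $$ (m, m)"
      using v Uc m pivot unfolding x_def col by (simp add: power_divide)
    moreover have "(v \<bullet> (U *\<^sub>v ?e))\<^sup>2 \<le> (v \<bullet> (U *\<^sub>v v)) * U $$ (m, m)"
      using pos_semidef_Cauchy_Schwarz[OF U v unit_vec_carrier[of n m]] Uc m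
      by (simp add: unit_vec_quadratic_form)
    ultimately have "(v \<bullet> x)\<^sup>2 \<le> v \<bullet> (U *\<^sub>v v)"
      using pivot by (simp add: pos_divide_le_eq)
    moreover have "v \<bullet> ((U - outer_square x) *\<^sub>v v) = v \<bullet> (U *\<^sub>v v) - (v \<bullet> x)\<^sup>2"
      using Uc x v quadratic_form_outer_square[OF x v]
      by (simp add: minus_mult_distrib_mat_vec[of _ n n] scalar_prod_minus_distrib[of _ n]
          mult_mat_vec_carrier[of _ n n])
    ultimately show ?thesis by simp
  qed
  ultimately show "pos_semidef n (U - outer_square x)"
    unfolding pos_semidef_def using minus_carrier_mat[OF outer_square_carrier[OF x]] by blast
qed

text \<open>
  Elimination runs from the last diagonal entry to the first. Diagonal entries that vanish stay
  zero, because their whole row is zero; so after the last step nothing remains.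
\<close>

lemma pos_semidef_sum_of_squares_aux:
  assumes "pos_semidef n U" "m \<le> n" "\<And>i. m \<le> i \<Longrightarrow> i < n \<Longrightarrow> U $$ (i, i) = 0"
  shows "\<exists>xs. set xs \<subseteq> carrier_vec n \<and> U = sum_outer n xs"
  using assms
proof (induction m arbitrary: U)
  case 0
  have "U \<in> carrier_mat n n"
    using 0(1) by (simp add: pos_semidef_def)
  moreover have "U $$ (i, j) = 0" if "i < n" "j < n" for i j
    using pos_semidef_entry_zero[OF 0(1) that] 0(3)[OF _ that(1)] by simp
  ultimately have "U = 0\<^sub>m n n"
    by (intro eq_matI) auto
  then show ?case by (intro exI[of _ "[]"]) simp
next
  case (Suc m)
  then have m: "m < n" by simp
  show ?case
  proof (cases "U $$ (m, m) = 0")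
    case True
    have "U $$ (i, i) = 0" if "m \<le> i" "i < n" for i
      using True Suc.prems(3)[of i] that by (cases "i = m") auto
    with Suc.IH[of U] Suc.prems(1) m show ?thesis by simp
  next
    case False
    then have pivot: "U $$ (m, m) > 0"
      using pos_semidef_diag_nonneg[OF Suc.prems(1) m] by simp
    define x where "x = (1 / sqrt (U $$ (m, m))) \<cdot>\<^sub>v col U m"
    have Uc: "U \<in> carrier_mat n n"
      using Suc.prems(1) by (simp add: pos_semidef_def)
    then have x: "x \<in> carrier_vec n"
      by (auto simp: x_def col_def)
    note elim = pos_semidef_eliminate[OF Suc.prems(1) m pivot, folded x_def]
    have "(U - outer_square x) $$ (i, i) = 0" if "m \<le> i" "i < n" for i
    proof (cases "i = m")
      case True
      then show ?thesis using elim(2)[OF m m] pivot by simp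
    next
      case False
      then have "U $$ (i, i) = 0"
        using Suc.prems(3)[of i] that by simp
      then show ?thesis
        using elim(2)[of i i] pos_semidef_entry_zero[OF Suc.prems(1) that(2) m] that by simp
    qed
    then obtain xs where xs: "set xs \<subseteq> carrier_vec n" "U - outer_square x = sum_outer n xs"
      using Suc.IH[OF elim(1)] m by auto
    have "U = outer_square x + (U - outer_square x)"
      using Uc outer_square_carrier[OF x] by (intro eq_matI) auto
    with xs x show ?thesis
      by (intro exI[of _ "x # xs"]) simp
  qed
qed

lemma pos_semidef_sum_of_squares:
  assumes "pos_semidef n U"
  obtains xs where "set xs \<subseteq> carrier_vec n" "U = sum_outer n xs"
  using pos_semidef_sum_of_squares_aux[OF assms, of n] by auto

section \<open>Cross-positivity and nonnegativity on orthogonal pairs\<close>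

lemma star_linearD:
  assumes "star_linear n A"
  shows star_linear_carrier: "\<And>U. U \<in> carrier_mat n n \<Longrightarrow> A U \<in> carrier_mat n n"
    and star_linear_add: "\<And>U V. U \<in> carrier_mat n n \<Longrightarrow> V \<in> carrier_mat n n \<Longrightarrow>
      A (U + V) = A U + A V"
    and star_linear_smult: "\<And>r U. U \<in> carrier_mat n n \<Longrightarrow> A (r \<cdot>\<^sub>m U) = r \<cdot>\<^sub>m A U"
  using assms by (auto simp: star_linear_def linear_map_mat_iff)

lemma star_linear_zero:
  assumes "star_linear n A"
  shows "A (0\<^sub>m n n) = 0\<^sub>m n n"
proof -
  have smult0: "0 \<cdot>\<^sub>m M = 0\<^sub>m n n" if "M \<in> carrier_mat n n" for M :: "real mat"
    using that by (intro eq_matI) auto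
  show ?thesis
    using star_linear_smult[OF assms zero_carrier_mat, of 0]
      star_linear_carrier[OF assms zero_carrier_mat] smult0 by simp
qed

lemma p_poly_eq_inner:
  assumes "star_linear n A" "x \<in> carrier_vec n" "y \<in> carrier_vec n"
  shows "p_poly A (x, y) = inner_mat (A (outer_square x)) (outer_square y)"
  using assms by (simp add: p_poly_def inner_mat_outer_square[of _ n] star_linear_carrier)

lemma inner_mat_sum_outer_right:
  assumes "M \<in> carrier_mat n n" "set ys \<subseteq> carrier_vec n"
  shows "inner_mat M (sum_outer n ys) = (\<Sum>y\<leftarrow>ys. inner_mat M (outer_square y))"
  using assms(2)
  by (induction ys) (use assms(1) in \<open>auto simp: inner_mat_zero_right inner_mat_add_right[of _ n]\<close>)

lemma inner_mat_sum_outer_left: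
  assumes "\<And>U. U \<in> carrier_mat n n \<Longrightarrow> F U \<in> carrier_mat n n"
    and "\<And>U V. U \<in> carrier_mat n n \<Longrightarrow> V \<in> carrier_mat n n \<Longrightarrow> F (U + V) = F U + F V"
    and "F (0\<^sub>m n n) = 0\<^sub>m n n"
    and "V \<in> carrier_mat n n" "set xs \<subseteq> carrier_vec n"
  shows "inner_mat (F (sum_outer n xs)) V = (\<Sum>x\<leftarrow>xs. inner_mat (F (outer_square x)) V)"
  using assms(5)
  by (induction xs) (use assms(1-4) in \<open>auto simp: inner_mat_zero_left inner_mat_add_left[of _ n]\<close>)

lemma inner_outer_squares:
  assumes "x \<in> carrier_vec n" "y \<in> carrier_vec n"
  shows "inner_mat (outer_square x) (outer_square y) = (y \<bullet> x)\<^sup>2"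
  using assms by (simp add: inner_mat_outer_square[of _ n] quadratic_form_outer_square)

text \<open>
  A sum of squares vanishes only termwise; this is what turns orthogonality of two positive
  semidefinite matrices into orthogonality of the vectors that compose them.
\<close>

lemma sum_outer_orthogonal:
  assumes xs: "set xs \<subseteq> carrier_vec n" and ys: "set ys \<subseteq> carrier_vec n"
    and zero: "inner_mat (sum_outer n xs) (sum_outer n ys) = 0"
    and x: "x \<in> set xs" and y: "y \<in> set ys"
  shows "y \<bullet> x = 0"
proof -
  have row: "inner_mat (outer_square x) (sum_outer n ys) = (\<Sum>y\<leftarrow>ys. (y \<bullet> x)\<^sup>2)"
    if "x \<in> set xs" for x
  proof -
    have "x \<in> carrier_vec n"
      using that xs by auto
    then show ?thesis
      using ys by (auto simp: inner_mat_sum_outer_right inner_outer_squares[of _ n]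
          intro!: arg_cong[where f = sum_list] map_cong)
  qed
  have "inner_mat (sum_outer n xs) (sum_outer n ys)
      = (\<Sum>x\<leftarrow>xs. inner_mat (outer_square x) (sum_outer n ys))"
    using inner_mat_sum_outer_left[of n "\<lambda>U. U" "sum_outer n ys" xs] xs ys by simp
  also have "\<dots> = (\<Sum>x\<leftarrow>xs. \<Sum>y\<leftarrow>ys. (y \<bullet> x)\<^sup>2)"
    using row by (auto intro!: arg_cong[where f = sum_list] map_cong)
  finally have "(\<Sum>x\<leftarrow>xs. \<Sum>y\<leftarrow>ys. (y \<bullet> x)\<^sup>2) = 0"
    using zero by simp
  then have "(\<Sum>y\<leftarrow>ys. (y \<bullet> x)\<^sup>2) = 0"
    using x by (subst (asm) sum_list_nonneg_eq_0_iff) (auto intro!: sum_list_nonneg)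
  then have "(y \<bullet> x)\<^sup>2 = 0"
    using y by (subst (asm) sum_list_nonneg_eq_0_iff) auto
  then show ?thesis by simp
qed

lemma cross_positive_iff_p_poly_nonneg:
  assumes A: "star_linear n A"
  shows "cross_positive n A \<longleftrightarrow> (\<forall>(x, y) \<in> V_I n. p_poly A (x, y) \<ge> 0)"
proof
  assume cp: "cross_positive n A"
  show "\<forall>(x, y) \<in> V_I n. p_poly A (x, y) \<ge> 0"
  proof clarify
    fix x y assume "(x, y) \<in> V_I n"
    then have xy: "x \<in> carrier_vec n" "y \<in> carrier_vec n" "y \<bullet> x = 0"
      by (auto simp: V_I_def)
    then have "inner_mat (outer_square x) (outer_square y) = 0"
      by (simp add: inner_outer_squares)
    then show "p_poly A (x, y) \<ge> 0"
      using cp xy pos_semidef_outer_square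
      by (simp add: p_poly_eq_inner[OF A] cross_positive_def)
  qed
next
  assume p: "\<forall>(x, y) \<in> V_I n. p_poly A (x, y) \<ge> 0"
  show "cross_positive n A"
    unfolding cross_positive_def
  proof (intro allI impI)
    fix U V assume U: "pos_semidef n U" and V: "pos_semidef n V" and UV: "inner_mat U V = 0"
    obtain xs where xs: "set xs \<subseteq> carrier_vec n" "U = sum_outer n xs"
      using pos_semidef_sum_of_squares[OF U] .
    obtain ys where ys: "set ys \<subseteq> carrier_vec n" "V = sum_outer n ys"
      using pos_semidef_sum_of_squares[OF V] .
    have term_nonneg: "inner_mat (A (outer_square x)) (outer_square y) \<ge> 0"
      if "x \<in> set xs" "y \<in> set ys" for x y
    proof -
      have "x \<in> carrier_vec n" "y \<in> carrier_vec n" "y \<bullet> x = 0"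
        using that xs ys UV sum_outer_orthogonal[of xs n ys x y] by auto
      then show ?thesis
        using p by (auto simp: V_I_def p_poly_eq_inner[OF A, symmetric])
    qed
    have "inner_mat (A U) V = (\<Sum>x\<leftarrow>xs. inner_mat (A (outer_square x)) V)"
      unfolding xs(2) using xs(1) ys
      by (intro inner_mat_sum_outer_left star_linearD[OF A] star_linear_zero[OF A]) auto
    also have "\<dots> \<ge> 0"
    proof (intro sum_list_nonneg, clarsimp)
      fix x assume x: "x \<in> set xs"
      then have "A (outer_square x) \<in> carrier_mat n n"
        using xs(1) by (intro star_linear_carrier[OF A]) auto
      then show "inner_mat (A (outer_square x)) V \<ge> 0"
        using ys term_nonneg[OF x]
        by (auto simp: inner_mat_sum_outer_right intro!: sum_list_nonneg)
    qed
    finally show "inner_mat (A U) V \<ge> 0" .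
  qed
qed

section \<open>The parametrisation of orthogonal pairs\<close>

text \<open>
  With \<open>b\<^sub>i = \<alpha>\<^sub>i\<^sub>-\<^sub>1x\<^sub>i\<^sub>-\<^sub>1x\<^sub>i\<close> inside the index range and \<open>b\<^sub>i = 0\<close> at both ends, the summands of
  \<open>y\<^sup>Tx\<close> are \<open>b\<^sub>i\<^sub>+\<^sub>1 - b\<^sub>i\<close>, so the sum collapses.
\<close>

lemma Psi_in_V_I:
  assumes n: "n \<ge> 2" and x: "x \<in> carrier_vec n"
  shows "Psi n (x, \<alpha>) \<in> V_I n"
proof -
  define y where "y = snd (Psi n (x, \<alpha>))"
  define b where "b i = (if i = 0 \<or> i \<ge> n then 0 else \<alpha> $ (i - 1) * x $ (i - 1) * x $ i)" for i
  have y: "y \<in> carrier_vec n"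
    by (simp add: y_def Psi_def)
  have "y $ i * x $ i = b (Suc i) - b i" if i: "i < n" for i
  proof -
    consider "i = 0" | "i = n - 1" "i \<noteq> 0" | "i \<noteq> 0" "Suc i < n"
      using i by linarith
    then show ?thesis
      using n i
      by cases (auto simp: y_def Psi_def b_def algebra_simps numeral_2_eq_2)
  qed
  then have "y \<bullet> x = (\<Sum>i<n. b (Suc i) - b i)"
    using x by (simp add: scalar_prod_def atLeast0LessThan)
  also have "\<dots> = 0"
    by (simp only: sum_lessThan_telescope) (simp add: b_def)
  finally have "(x, y) \<in> V_I n"
    using x y by (simp add: V_I_def)
  moreover have "Psi n (x, \<alpha>) = (x, y)"
    by (simp add: y_def Psi_def)
  ultimately show ?thesis by simp
qed

text \<open>
  The telescoping read backwards: \<open>\<alpha>\<^sub>ix\<^sub>ix\<^sub>i\<^sub>+\<^sub>1\<close> must be the partial sum of \<open>y\<^sup>Tx\<close> up to \<open>i\<close>, which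
  determines \<open>\<alpha>\<close>. The equation for the last coordinate of \<open>y\<close> is then exactly \<open>y\<^sup>Tx = 0\<close>.
\<close>

lemma Psi_surj_nonvanishing:
  assumes n: "n \<ge> 2" and xy: "(x, y) \<in> V_I n" and nz: "\<And>i. i < n \<Longrightarrow> x $ i \<noteq> 0"
  obtains \<alpha> where "\<alpha> \<in> carrier_vec (n - 1)" "Psi n (x, \<alpha>) = (x, y)"
proof -
  define S where "S k = (\<Sum>j<k. y $ j * x $ j)" for k
  define \<alpha> where "\<alpha> = vec (n - 1) (\<lambda>i. S (Suc i) / (x $ i * x $ (i + 1)))"
  have x: "x \<in> carrier_vec n" and y: "y \<in> carrier_vec n" and "y \<bullet> x = 0"
    using xy by (auto simp: V_I_def)
  then have Sn: "S n = 0"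
    by (simp add: S_def scalar_prod_def atLeast0LessThan)
  have S0: "S 0 = 0" and SSuc: "\<And>i. S (Suc i) = S i + y $ i * x $ i"
    by (simp_all add: S_def)
  have next_term: "\<alpha> $ i * x $ (i + 1) = S (Suc i) / x $ i" if "Suc i < n" for i
    using that nz[of i] nz[of "Suc i"] by (simp add: \<alpha>_def)
  have prev_term: "\<alpha> $ (i - 1) * x $ (i - 1) = S i / x $ i" if "0 < i" "i < n" for i
    using that nz[of i] nz[of "i - 1"] by (cases i) (simp_all add: \<alpha>_def)
  have "snd (Psi n (x, \<alpha>)) = y"
  proof (rule eq_vecI)
    fix i assume "i < dim_vec y"
    then have i: "i < n" using y by simp
    consider "i = 0" | "i = n - 1" "i \<noteq> 0" | "i \<noteq> 0" "Suc i < n"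
      using i by linarith
    then show "snd (Psi n (x, \<alpha>)) $ i = y $ i"
    proof cases
      case 1
      then show ?thesis
        using n next_term[of 0] nz[of 0] S0 SSuc[of 0] by (simp add: Psi_def)
    next
      case 2
      then have "snd (Psi n (x, \<alpha>)) $ i = - (\<alpha> $ (i - 1) * x $ (i - 1))"
        using n by (simp add: Psi_def numeral_2_eq_2)
      also have "\<dots> = - (S i / x $ i)"
        using 2 i by (simp only: prev_term)
      also have "S i = - (y $ i * x $ i)"
        using Sn SSuc[of i] 2 n by simp
      finally show ?thesis using nz[OF i] by simp
    next
      case 3
      then have "snd (Psi n (x, \<alpha>)) $ i = \<alpha> $ i * x $ (i + 1) - \<alpha> $ (i - 1) * x $ (i - 1)"
        by (simp add: Psi_def)
      also have "\<dots> = S (Suc i) / x $ i - S i / x $ i"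
        using 3 i by (simp only: prev_term next_term)
      also have "\<dots> = y $ i"
        using nz[OF i] by (simp add: SSuc field_simps)
      finally show ?thesis .
    qed
  qed (use y in \<open>simp add: Psi_def\<close>)
  then have "Psi n (x, \<alpha>) = (x, y)"
    by (simp add: Psi_def)
  moreover have "\<alpha> \<in> carrier_vec (n - 1)"
    by (simp add: \<alpha>_def)
  ultimately show ?thesis using that by blast
qed

section \<open>Continuity along lines\<close>

text \<open>
  \<open>A((x + tu)(x + tu)\<^sup>T)\<close> is a polynomial in \<open>t\<close> with matrix coefficients. The mixed coefficient
  \<open>xu\<^sup>T + ux\<^sup>T\<close> is written as \<open>(x + u)(x + u)\<^sup>T - xx\<^sup>T - uu\<^sup>T\<close>, so that only images of rank-one squares
  occur.
\<close>

lemma star_linear_outer_square_line: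
  assumes A: "star_linear n A" and x: "x \<in> carrier_vec n" and u: "u \<in> carrier_vec n"
    and ij: "i < n" "j < n"
  shows "A (outer_square (x + t \<cdot>\<^sub>v u)) $$ (i, j)
    = (1 - t) * A (outer_square x) $$ (i, j) + t * A (outer_square (x + u)) $$ (i, j)
      + (t\<^sup>2 - t) * A (outer_square u) $$ (i, j)"
proof -
  let ?X = "outer_square x" and ?Y = "outer_square (x + u)" and ?Z = "outer_square u"
  have c: "?X \<in> carrier_mat n n" "?Y \<in> carrier_mat n n" "?Z \<in> carrier_mat n n"
    using x u by auto
  have "outer_square (x + t \<cdot>\<^sub>v u) = ((1 - t) \<cdot>\<^sub>m ?X + t \<cdot>\<^sub>m ?Y) + (t\<^sup>2 - t) \<cdot>\<^sub>m ?Z"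
    using x u
    by (intro eq_matI) (auto simp: outer_square_def power2_eq_square algebra_simps)
  then have "A (outer_square (x + t \<cdot>\<^sub>v u))
      = ((1 - t) \<cdot>\<^sub>m A ?X + t \<cdot>\<^sub>m A ?Y) + (t\<^sup>2 - t) \<cdot>\<^sub>m A ?Z"
    using c by (simp add: star_linear_add[OF A] star_linear_smult[OF A])
  then show ?thesis
    using ij c[THEN star_linear_carrier[OF A]] by simp
qed

lemma continuous_p_poly_line:
  assumes A: "star_linear n A" and x: "x \<in> carrier_vec n" and u: "u \<in> carrier_vec n"
    and y: "\<And>t. y t \<in> carrier_vec n" and cont: "\<And>i. i < n \<Longrightarrow> isCont (\<lambda>t. y t $ i) s"
  shows "isCont (\<lambda>t. p_poly A (x + t \<cdot>\<^sub>v u, y t)) s"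
proof -
  have "p_poly A (x + t \<cdot>\<^sub>v u, y t) = (\<Sum>i<n. \<Sum>j<n.
      ((1 - t) * A (outer_square x) $$ (i, j) + t * A (outer_square (x + u)) $$ (i, j)
        + (t\<^sup>2 - t) * A (outer_square u) $$ (i, j)) * (y t $ i * y t $ j))" for t
  proof -
    have "A (outer_square (x + t \<cdot>\<^sub>v u)) \<in> carrier_mat n n"
      using x u by (intro star_linear_carrier[OF A] outer_square_carrier) auto
    then show ?thesis
      using star_linear_outer_square_line[OF A x u] y
      by (simp add: p_poly_def quadratic_form_eq_sum)
  qed
  then show ?thesis
    using cont by (auto intro!: continuous_intros)
qed

lemma p_poly_scale_right:
  assumes A: "star_linear n A" and x: "x \<in> carrier_vec n" and y: "y \<in> carrier_vec n"
  shows "p_poly A (x, c \<cdot>\<^sub>v y) = c\<^sup>2 * p_poly A (x, y)"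
  using star_linear_carrier[OF A outer_square_carrier[OF x]] y
  by (simp add: p_poly_def mult_mat_vec[of _ n n] power2_eq_square)

lemma p_poly_zero_left:
  assumes A: "star_linear n A" and y: "y \<in> carrier_vec n"
  shows "p_poly A (0\<^sub>v n, y) = 0"
proof -
  have "outer_square (0\<^sub>v n) = 0\<^sub>m n n"
    by (intro eq_matI) (auto simp: outer_square_def)
  then show ?thesis
    using y by (simp add: p_poly_def star_linear_zero[OF A] quadratic_form_eq_sum[of _ n])
qed

text \<open>
  Replacing the zero coordinates of \<open>x\<close> by \<open>t\<close> gives vectors \<open>x\<^sub>t\<close> without zero coordinates, for
  \<open>t \<noteq> 0\<close>. The vector \<open>(x\<^sub>t\<^sup>Tx\<^sub>t)y - (y\<^sup>Tx\<^sub>t)x\<^sub>t\<close>, which is the orthogonal projection of \<open>y\<close> onto the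
  complement of \<open>x\<^sub>t\<close> cleared of denominators, keeps the pair in \<open>V(I)\<close>; at \<open>t = 0\<close> it is
  \<open>(x\<^sup>Tx)y\<close>.
\<close>

lemma p_poly_nonneg_from_nonvanishing:
  assumes A: "star_linear n A" and xy: "(x, y) \<in> V_I n"
    and generic: "\<And>x y. (x, y) \<in> V_I n \<Longrightarrow> (\<And>i. i < n \<Longrightarrow> x $ i \<noteq> 0) \<Longrightarrow> p_poly A (x, y) \<ge> 0"
  shows "p_poly A (x, y) \<ge> 0"
proof (cases "x = 0\<^sub>v n")
  case True
  with xy show ?thesis
    using p_poly_zero_left[OF A] by (auto simp: V_I_def)
next
  case False
  have x: "x \<in> carrier_vec n" and y: "y \<in> carrier_vec n" and orth: "y \<bullet> x = 0"
    using xy by (auto simp: V_I_def)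
  define u :: "real vec" where "u = vec n (\<lambda>i. if x $ i = 0 then 1 else 0)"
  define X where "X t = x + t \<cdot>\<^sub>v u" for t
  define Y where "Y t = (X t \<bullet> X t) \<cdot>\<^sub>v y - (y \<bullet> X t) \<cdot>\<^sub>v X t" for t
  have u: "u \<in> carrier_vec n" by (simp add: u_def)
  have X: "X t \<in> carrier_vec n" for t
    using x u by (simp add: X_def)
  have Y: "Y t \<in> carrier_vec n" for t
    using X y by (simp add: Y_def)
  have X_index: "X t $ i = x $ i + t * u $ i" if "i < n" for t i
    using that x u by (simp add: X_def)
  have "isCont (\<lambda>t. Y t $ i) 0" if "i < n" for i
  proof -
    have "Y t $ i = (\<Sum>k<n. (x $ k + t * u $ k) * (x $ k + t * u $ k)) * y $ i
        - (\<Sum>k<n. y $ k * (x $ k + t * u $ k)) * (x $ i + t * u $ i)" for t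
      using that X[of t] y by (simp add: Y_def scalar_prod_def atLeast0LessThan X_index)
    then show ?thesis by (auto intro!: continuous_intros)
  qed
  then have "isCont (\<lambda>t. p_poly A (X t, Y t)) 0"
    unfolding X_def using Y by (intro continuous_p_poly_line[OF A x u]) auto
  then have lim: "((\<lambda>t. p_poly A (X t, Y t)) \<longlongrightarrow> p_poly A (X 0, Y 0)) (at 0)"
    by (simp add: isCont_def)
  have nonneg: "p_poly A (X t, Y t) \<ge> 0" if "t \<noteq> 0" for t
  proof (rule generic)
    show "X t $ i \<noteq> 0" if "i < n" for i
      using that \<open>t \<noteq> 0\<close> by (simp add: X_index u_def)
    have "Y t \<bullet> X t = (X t \<bullet> X t) * (y \<bullet> X t) - (y \<bullet> X t) * (X t \<bullet> X t)"
      using X[of t] y by (simp add: Y_def minus_scalar_prod_distrib[of _ n])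
    then show "(X t, Y t) \<in> V_I n"
      using X Y by (simp add: V_I_def)
  qed
  have "p_poly A (X 0, Y 0) \<ge> 0"
    using nonneg by (intro tendsto_lowerbound[OF lim]) (auto simp: eventually_at_filter)
  moreover have "X 0 = x"
    using x u by (intro eq_vecI) (auto simp: X_def)
  moreover from this have "Y 0 = (x \<bullet> x) \<cdot>\<^sub>v y"
    using x y orth by (intro eq_vecI) (auto simp: Y_def)
  ultimately have scaled: "(x \<bullet> x)\<^sup>2 * p_poly A (x, y) \<ge> 0"
    using p_poly_scale_right[OF A x y] by simp
  have "x \<bullet> x \<noteq> 0"
  proof
    assume "x \<bullet> x = 0"
    then have "\<forall>i<n. x $ i = 0"
      using x by (auto simp: scalar_prod_def sum_nonneg_eq_0_iff)
    with x have "x = 0\<^sub>v n" by (intro eq_vecI) auto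
    with False show False ..
  qed
  then have "(x \<bullet> x)\<^sup>2 > 0" by simp
  with scaled show ?thesis by (simp add: zero_le_mult_iff)
qed

lemma p_poly_nonneg_iff_q_poly_nonneg:
  assumes n: "n \<ge> 2" and A: "star_linear n A"
  shows "(\<forall>(x, y) \<in> V_I n. p_poly A (x, y) \<ge> 0) \<longleftrightarrow>
    (\<forall>(x, \<alpha>) \<in> carrier_vec n \<times> carrier_vec (n - 1). q_poly n A (x, \<alpha>) \<ge> 0)"
proof
  assume p: "\<forall>(x, y) \<in> V_I n. p_poly A (x, y) \<ge> 0"
  show "\<forall>(x, \<alpha>) \<in> carrier_vec n \<times> carrier_vec (n - 1). q_poly n A (x, \<alpha>) \<ge> 0"
  proof clarify
    fix x \<alpha> :: "real vec" assume "x \<in> carrier_vec n"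
    then have "Psi n (x, \<alpha>) \<in> V_I n"
      by (rule Psi_in_V_I[OF n])
    with p show "q_poly n A (x, \<alpha>) \<ge> 0"
      by (cases "Psi n (x, \<alpha>)") (auto simp: q_poly_def)
  qed
next
  assume q: "\<forall>(x, \<alpha>) \<in> carrier_vec n \<times> carrier_vec (n - 1). q_poly n A (x, \<alpha>) \<ge> 0"
  have "p_poly A (x, y) \<ge> 0" if xy: "(x, y) \<in> V_I n" and nz: "\<And>i. i < n \<Longrightarrow> x $ i \<noteq> 0" for x y
  proof -
    obtain \<alpha> where "\<alpha> \<in> carrier_vec (n - 1)" "Psi n (x, \<alpha>) = (x, y)"
      using Psi_surj_nonvanishing[OF n xy nz] .
    moreover have "x \<in> carrier_vec n"
      using xy by (simp add: V_I_def)
    ultimately show ?thesis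
      using q by (force simp: q_poly_def)
  qed
  then show "\<forall>(x, y) \<in> V_I n. p_poly A (x, y) \<ge> 0"
    using p_poly_nonneg_from_nonvanishing[OF A] by blast
qed

theorem proposition2p5:
  fixes n :: nat and A :: "real mat \<Rightarrow> real mat"
  assumes "n \<ge> 2"
    and "star_linear n A"
  shows "(cross_positive n A \<longleftrightarrow> (\<forall>(x, y) \<in> V_I n. p_poly A (x, y) \<ge> 0)) \<and>
         ((\<forall>(x, y) \<in> V_I n. p_poly A (x, y) \<ge> 0) \<longleftrightarrow>
          (\<forall>(x, \<alpha>) \<in> carrier_vec n \<times> carrier_vec (n - 1). q_poly n A (x, \<alpha>) \<ge> 0))"
  using cross_positive_iff_p_poly_nonneg[OF assms(2)]
    p_poly_nonneg_iff_q_poly_nonneg[OF assms] by blast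

end
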